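(* If $G$ and $H$ are connected graphs, each of order at least $2$, then $$\mathrm{gp}_{\mathrm o}(G\,\square\, H)=\min\{\mathrm{gp}_{\mathrm o}(G),\mathrm{gp}_{\mathrm o}(H)\}.$$
   Context: All graphs are finite and simple. The Cartesian product $G\,\square\,H$ has vertex set $V(G)\times V(H)$, with $(g,h)$ and $(g',h')$ adjacent if either $gg'\in E(G)$ and $h=h'$, or $g=g'$ and $hh'\in E(H)$. For a graph $G$ and $X\subseteq V(G)$, vertices $u,v\in V(G)$ are $X$-positionable if for every shortest $u,v$-path $P$ in $G$ we have $V(P)\cap X\subseteq\{u,v\}$. A set $X\subseteq V(G)$ is an outer general position set if every $u,v\in X$ are $X$-positionable and every $u\in X$, $v\in V(G)\setminus X$ are $X$-positionable. The outer general position number $\mathrm{gp}_{\mathrm o}(G)$ is the cardinality of a largest outer general position set of $G$. *)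

theory Defs
  imports "Graph_Theory.Graph_Theory"
begin

text \<open>
  Finite simple graphs are \<^locale>\<open>pair_graph\<close>s: a vertex set together with a finite, symmetric,
  irreflexive relation on it.  An undirected edge is represented by its two orientations.
\<close>

definition cartesian_product ::
  "'a pair_pre_digraph \<Rightarrow> 'b pair_pre_digraph \<Rightarrow> ('a \<times> 'b) pair_pre_digraph" (infixl "\<box>" 70) where
  "G \<box> H = \<lparr> pverts = pverts G \<times> pverts H,
             parcs = {((g, h), (g', h')) | g h g' h'.
                        (g, g') \<in> parcs G \<and> h = h' \<and> h \<in> pverts H \<or>
                        g = g' \<and> g \<in> pverts G \<and> (h, h') \<in> parcs H} \<rparr>"

definition path_between :: "'a pair_pre_digraph \<Rightarrow> 'a \<Rightarrow> 'a vwalk \<Rightarrow> 'a \<Rightarrow> bool" where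
  "path_between G u p v \<longleftrightarrow> vpath p (with_proj G) \<and> hd p = u \<and> last p = v"

definition shortest_path :: "'a pair_pre_digraph \<Rightarrow> 'a \<Rightarrow> 'a vwalk \<Rightarrow> 'a \<Rightarrow> bool" where
  "shortest_path G u p v \<longleftrightarrow>
     path_between G u p v \<and> (\<forall>q. path_between G u q v \<longrightarrow> vwalk_length p \<le> vwalk_length q)"

definition positionable :: "'a pair_pre_digraph \<Rightarrow> 'a set \<Rightarrow> 'a \<Rightarrow> 'a \<Rightarrow> bool" where
  "positionable G X u v \<longleftrightarrow> (\<forall>p. shortest_path G u p v \<longrightarrow> set p \<inter> X \<subseteq> {u, v})"

definition outer_general_position :: "'a pair_pre_digraph \<Rightarrow> 'a set \<Rightarrow> bool" where
  "outer_general_position G X \<longleftrightarrow>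
     X \<subseteq> pverts G \<and>
     (\<forall>u\<in>X. \<forall>v\<in>X. positionable G X u v) \<and>
     (\<forall>u\<in>X. \<forall>v\<in>pverts G - X. positionable G X u v)"

definition gp_outer :: "'a pair_pre_digraph \<Rightarrow> nat" where
  "gp_outer G = Max {card X | X. outer_general_position G X}"

text \<open>The following two lemmas show that the maximum is taken over a finite nonempty set.\<close>

lemma finite_outer_general_position_cards:
  assumes "finite (pverts G)"
  shows "finite {card X | X. outer_general_position G X}"
proof -
  have "{card X | X. outer_general_position G X} \<subseteq> card ` Pow (pverts G)"
    by (auto simp: outer_general_position_def)
  then show ?thesis
    using assms by (meson finite_Pow_iff finite_imageI finite_subset)
qed

lemma outer_general_position_empty: "outer_general_position G {}"
  by (simp add: outer_general_position_def)

lemma pair_graph_cartesian_product: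
  assumes "pair_graph G" and "pair_graph H"
  shows "pair_graph (G \<box> H)"
proof -
  interpret G: pair_graph G by fact
  interpret H: pair_graph H by fact
  have sub: "parcs (G \<box> H) \<subseteq> (pverts G \<times> pverts H) \<times> (pverts G \<times> pverts H)"
    by (auto simp: cartesian_product_def dest: G.wellformed' H.wellformed')
  have fin: "finite (parcs (G \<box> H))"
    by (rule finite_subset[OF sub]) (simp add: G.pair_finite_verts H.pair_finite_verts)
  have "sym (parcs (G \<box> H))"
    using G.pair_sym_arcs H.pair_sym_arcs
    by (auto simp: symmetric_def cartesian_product_def sym_def)
  moreover have "fst e \<noteq> snd e" if "e \<in> parcs (G \<box> H)" for e
    using that G.pair_no_loops H.pair_no_loops by (fastforce simp: cartesian_product_def)
  ultimately show ?thesis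
    using sub fin G.pair_finite_verts H.pair_finite_verts
    by unfold_locales (auto simp: symmetric_def cartesian_product_def dest: G.wellformed' H.wellformed')
qed

end

theory Submission
  imports Defs
begin

text \<open>
  Call \<open>x\<close> maximally distant from \<open>u\<close> if no neighbour of \<open>x\<close> is farther from \<open>u\<close> than \<open>x\<close> is.
  A shortest path starting in \<open>u\<close> can be prolonged beyond \<open>x\<close> exactly if \<open>x\<close> is not maximally
  distant from \<open>u\<close>, so in a connected graph the outer general position sets are the sets of
  pairwise mutually maximally distant vertices.  Distances in a Cartesian product add up, so
  \<open>(x, y)\<close> is maximally distant from \<open>(u, v)\<close> iff both coordinates are.  In a graph without isolated
  vertices no vertex is maximally distant from itself; therefore both projections of an outer
  general position set of the product are injective, with outer general position sets as images.
  Conversely, the graph of a bijection between outer general position sets of the factors is one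
  of the product.
\<close>

section \<open>Distances, walks and their shortening to paths\<close>

definition graph_dist :: "'a pair_pre_digraph \<Rightarrow> 'a \<Rightarrow> 'a \<Rightarrow> nat" where
  "graph_dist G u v = (LEAST n. (u, v) \<in> parcs G ^^ n)"

definition maximally_distant :: "'a pair_pre_digraph \<Rightarrow> 'a \<Rightarrow> 'a \<Rightarrow> bool" where
  "maximally_distant G u x \<longleftrightarrow> (\<forall>w. (x, w) \<in> parcs G \<longrightarrow> graph_dist G u w \<le> graph_dist G u x)"

lemma graph_dist_le: "(u, v) \<in> parcs G ^^ n \<Longrightarrow> graph_dist G u v \<le> n"
  unfolding graph_dist_def by (rule Least_le)

lemma graph_dist_self [simp]: "graph_dist G u u = 0"
  using graph_dist_le[where n = 0] by fastforce

lemma length_vwalk_to_vpath: "length (vwalk_to_vpath p) \<le> length p"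
proof (induct p rule: vwalk_to_vpath_induct3)
  case (in_set x xs)
  then show ?case
    using length_dropWhile_le[of "\<lambda>y. y \<noteq> x" xs] by simp
qed auto

text \<open>Cutting out the stretch between two occurrences of a vertex drops at least one entry, so
  in the \<open>in_set\<close> case the lengths cannot agree. Walks that are as short as possible
  are thereby recognised as paths.\<close>

lemma length_vwalk_to_vpath_eq_imp_distinct:
  "length (vwalk_to_vpath p) = length p \<Longrightarrow> distinct p"
proof (induct p rule: vwalk_to_vpath_induct3)
  case (in_set x xs)
  then show ?case
    using length_dropWhile_le[of "\<lambda>y. y \<noteq> x" xs]
      length_vwalk_to_vpath[of "dropWhile (\<lambda>y. y \<noteq> x) xs"] by simp
qed auto

text \<open>A walk along \<open>n\<close> arcs lists \<open>n + 1\<close> vertices, hence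
  \<open>Suc n\<close>. The hypothesis on \<open>u\<close> matters for \<open>n = 0\<close>, where
  the identity relation also relates elements outside the graph.\<close>

lemma (in pair_wf_digraph) relpow_conv_vwalk:
  assumes "u \<in> pverts G"
  shows "(u, v) \<in> parcs G ^^ n \<longleftrightarrow>
    (\<exists>p. vwalk p (with_proj G) \<and> hd p = u \<and> last p = v \<and> length p = Suc n)"
  using assms
proof (induction n arbitrary: u)
  case 0
  show ?case
  proof
    assume "(u, v) \<in> parcs G ^^ 0"
    then show "\<exists>p. vwalk p (with_proj G) \<and> hd p = u \<and> last p = v \<and> length p = Suc 0"
      using 0 by (intro exI[of _ "[u]"]) simp
  qed (auto simp: length_Suc_conv)
next
  case (Suc n)
  show ?case
  proof
    assume "(u, v) \<in> parcs G ^^ Suc n"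
    then obtain w where w: "(u, w) \<in> parcs G" "(w, v) \<in> parcs G ^^ n"
      by (meson relpow_Suc_D2)
    with Suc.IH[of w] obtain p where
      "vwalk p (with_proj G)" "hd p = w" "last p = v" "length p = Suc n"
      using in_arcsD2 by blast
    with w Suc.prems show
      "\<exists>p. vwalk p (with_proj G) \<and> hd p = u \<and> last p = v \<and> length p = Suc (Suc n)"
      by (intro exI[of _ "u # p"]) (auto intro!: vwalk_consI)
  next
    assume "\<exists>p. vwalk p (with_proj G) \<and> hd p = u \<and> last p = v \<and> length p = Suc (Suc n)"
    then obtain w q where p: "vwalk (u # w # q) (with_proj G)" "last (w # q) = v" "length q = n"
      by (auto simp: length_Suc_conv split: if_splits)
    then have "(u, w) \<in> parcs G" "vwalk (w # q) (with_proj G)"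
      by (auto elim: vwalk_consE)
    moreover from this have "(w, v) \<in> parcs G ^^ n"
      using p Suc.IH[of w] in_arcsD2 by (metis length_Cons list.sel(1))
    ultimately show "(u, v) \<in> parcs G ^^ Suc n"
      by (meson relpow_Suc_I2)
  qed
qed

text \<open>Reachability is phrased by the closure of \<open>parcs G\<close> because this unfolds
  into relation powers: the \<open>LEAST\<close> in \<open>graph_dist\<close> is then attained.
  Without reachability its value would be unspecified.\<close>

locale connected_pair_graph = pair_graph +
  assumes vertices_reachable: "u \<in> pverts G \<Longrightarrow> v \<in> pverts G \<Longrightarrow> (u, v) \<in> (parcs G)\<^sup>*"
begin

lemma relpow_graph_dist:
  assumes "u \<in> pverts G" "v \<in> pverts G"
  shows "(u, v) \<in> parcs G ^^ graph_dist G u v"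
  using vertices_reachable[OF assms] unfolding graph_dist_def rtrancl_power
  by (rule LeastI_ex)

lemma graph_dist_eq_0_iff:
  assumes "u \<in> pverts G" "v \<in> pverts G"
  shows "graph_dist G u v = 0 \<longleftrightarrow> u = v"
  using relpow_graph_dist[OF assms] by auto

lemma graph_dist_triangle:
  assumes "u \<in> pverts G" "v \<in> pverts G" "w \<in> pverts G"
  shows "graph_dist G u w \<le> graph_dist G u v + graph_dist G v w"
  using relpow_graph_dist[of u v] relpow_graph_dist[of v w] assms
  by (intro graph_dist_le) (auto simp: relpow_add)

lemma graph_dist_arc:
  assumes "(u, v) \<in> parcs G"
  shows "graph_dist G u v = 1"
proof -
  have "graph_dist G u v \<le> 1"
    using assms by (intro graph_dist_le) simp
  moreover have "graph_dist G u v \<noteq> 0"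
    using graph_dist_eq_0_iff[of u v] assms pair_no_loops[OF assms] by (auto dest: wellformed')
  ultimately show ?thesis by simp
qed

text \<open>Here \<open>w\<close> is the second vertex of a shortest walk: the rest of that walk
  bounds \<open>graph_dist G w v\<close> from above, the triangle inequality from below.\<close>

lemma graph_dist_step:
  assumes "u \<in> pverts G" "v \<in> pverts G" "u \<noteq> v"
  obtains w where "(u, w) \<in> parcs G" "graph_dist G u v = Suc (graph_dist G w v)"
proof -
  obtain n where n: "graph_dist G u v = Suc n"
    using graph_dist_eq_0_iff[OF assms(1,2)] assms(3) by (cases "graph_dist G u v") auto
  then obtain w where w: "(u, w) \<in> parcs G" "(w, v) \<in> parcs G ^^ n"
    using relpow_graph_dist[OF assms(1,2)] by (metis relpow_Suc_D2)
  have "graph_dist G u v \<le> 1 + graph_dist G w v"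
    using graph_dist_triangle[of u w v] graph_dist_arc[OF w(1)] assms w(1)
    by (auto dest: wellformed')
  then have "graph_dist G u v = Suc (graph_dist G w v)"
    using graph_dist_le[OF w(2)] n by simp
  with w(1) that show thesis by blast
qed

section \<open>Shortest paths in terms of distances\<close>

lemma vwalk_length_ge:
  assumes "vwalk p (with_proj G)"
  shows "Suc (graph_dist G (hd p) (last p)) \<le> length p"
proof -
  have "p \<noteq> []" "hd p \<in> pverts G"
    using assms by (auto simp: vwalk_def)
  then have "(hd p, last p) \<in> parcs G ^^ (length p - 1)"
    using assms relpow_conv_vwalk[of "hd p" "last p" "length p - 1"] by force
  from graph_dist_le[OF this] \<open>p \<noteq> []\<close> show ?thesis by (cases p) auto
qed

text \<open>Distinctness comes for free: shortening a walk of this length to a path cannot go below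
  the distance, so nothing is removed. Since such a walk exists, no shortest path can be
  longer.\<close>

lemma shortest_path_conv:
  assumes "u \<in> pverts G" "v \<in> pverts G"
  shows "shortest_path G u p v \<longleftrightarrow>
    vwalk p (with_proj G) \<and> hd p = u \<and> last p = v \<and> length p = Suc (graph_dist G u v)"
    (is "_ \<longleftrightarrow> ?R p")
proof -
  have path: "path_between G u q v" if "?R q" for q
  proof -
    have "Suc (graph_dist G u v) \<le> length (vwalk_to_vpath q)"
      using that vwalk_length_ge[of "vwalk_to_vpath q"] vwalk_to_vpath_vpath[of q "with_proj G"]
      by (auto simp: vwalk_to_vpath_hd vwalk_to_vpath_last)
    then have "distinct q"
      using that length_vwalk_to_vpath[of q]
      by (intro length_vwalk_to_vpath_eq_imp_distinct) simp
    with that show ?thesis by (auto simp: path_between_def)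
  qed
  obtain q where q: "?R q"
    using relpow_conv_vwalk[OF assms(1)] relpow_graph_dist[OF assms] by blast
  show ?thesis
  proof
    assume p: "shortest_path G u p v"
    then have "vwalk_length p \<le> vwalk_length q"
      using path[OF q] by (simp add: shortest_path_def)
    moreover have "vwalk p (with_proj G)" "hd p = u" "last p = v"
      using p by (auto simp: shortest_path_def path_between_def)
    ultimately show "?R p"
      using vwalk_length_ge[of p] q by auto
  next
    assume p: "?R p"
    then have "vwalk_length p \<le> vwalk_length r" if "path_between G u r v" for r
      using that vwalk_length_ge[of r] by (auto simp: path_between_def)
    with path[OF p] show "shortest_path G u p v"
      by (simp add: shortest_path_def)
  qed
qed

lemma in_shortest_path_iff:
  assumes "u \<in> pverts G" "v \<in> pverts G" "x \<in> pverts G"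
  shows "(\<exists>p. shortest_path G u p v \<and> x \<in> set p) \<longleftrightarrow>
    graph_dist G u x + graph_dist G x v = graph_dist G u v"
proof
  assume "\<exists>p. shortest_path G u p v \<and> x \<in> set p"
  then obtain p where p: "vwalk p (with_proj G)" "hd p = u" "last p = v"
    "length p = Suc (graph_dist G u v)" "x \<in> set p"
    using shortest_path_conv[OF assms(1,2)] by blast
  \<comment> \<open>Splitting \<open>p\<close> at \<open>x\<close> gives walks from \<open>u\<close>
    to \<open>x\<close> and from \<open>x\<close> to \<open>v\<close>; \<open>x\<close> is counted
    in both, which matches the two \<open>Suc\<close> in the length bounds.\<close>
  from \<open>x \<in> set p\<close> obtain a b where ab: "p = a @ x # b"
    by (meson split_list)
  have "vwalk (a @ [x]) (with_proj G)"
    using p(1) ab vwalkI_append_l[of "a @ [x]" b] by simp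
  moreover have "hd (a @ [x]) = u"
    using p(2) ab by (cases a) auto
  moreover have "vwalk (x # b) (with_proj G)"
    using p(1) ab vwalkI_append_r[of "x # b" a] by simp
  moreover have "last (x # b) = v"
    using p(3) ab by simp
  ultimately have "graph_dist G u x + graph_dist G x v \<le> graph_dist G u v"
    using vwalk_length_ge[of "a @ [x]"] vwalk_length_ge[of "x # b"] p(4) ab by simp
  with graph_dist_triangle[of u x v] assms
  show "graph_dist G u x + graph_dist G x v = graph_dist G u v" by simp
next
  assume eq: "graph_dist G u x + graph_dist G x v = graph_dist G u v"
  obtain p where p: "vwalk p (with_proj G)" "hd p = u" "last p = x"
    "length p = Suc (graph_dist G u x)"
    using relpow_conv_vwalk[of u] relpow_graph_dist[of u x] assms by blast
  obtain q where q: "vwalk q (with_proj G)" "hd q = x" "last q = v"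
    "length q = Suc (graph_dist G x v)"
    using relpow_conv_vwalk[of x] relpow_graph_dist[of x v] assms by blast
  have ne: "p \<noteq> []" "q \<noteq> []" using p q by auto
  then have join: "joinable p q" using p q by (simp add: joinable_def)
  have "vwalk (p \<oplus> q) (with_proj G)"
    using join p(1) q(1) by (simp add: vwalk_joinI_vwalk)
  moreover have "hd (p \<oplus> q) = u" "last (p \<oplus> q) = v"
    using join p q by (simp_all add: vwalk_join_hd vwalk_join_last)
  \<comment> \<open>Joining keeps only one of the two copies of \<open>x\<close>, so one
    \<open>Suc\<close> disappears.\<close>
  moreover have "length (p \<oplus> q) = Suc (graph_dist G u v)"
    using p q eq by (simp add: vwalk_join_def)
  moreover have "x \<in> set (p \<oplus> q)"
    using p(3) ne last_in_set[of p] by (simp add: vwalk_join_def)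
  ultimately show "\<exists>p. shortest_path G u p v \<and> x \<in> set p"
    using shortest_path_conv[OF assms(1,2)] by blast
qed

section \<open>Maximal distance and outer general position\<close>

lemma maximally_distant_iff:
  assumes "u \<in> pverts G" "x \<in> pverts G"
  shows "maximally_distant G u x \<longleftrightarrow>
    (\<forall>v\<in>pverts G - {x}. graph_dist G u x + graph_dist G x v \<noteq> graph_dist G u v)"
proof
  assume max: "maximally_distant G u x"
  show "\<forall>v\<in>pverts G - {x}. graph_dist G u x + graph_dist G x v \<noteq> graph_dist G u v"
  proof
    fix v assume v: "v \<in> pverts G - {x}"
    then obtain w where w: "(x, w) \<in> parcs G" "graph_dist G x v = Suc (graph_dist G w v)"
      using graph_dist_step[of x v] assms by blast
    \<comment> \<open>The first arc from \<open>x\<close> towards \<open>v\<close> leads to a vertex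
      \<open>w\<close> no farther from \<open>u\<close> than \<open>x\<close>, so the detour through
      \<open>w\<close> beats the route through \<open>x\<close> by at least one.\<close>
    have "graph_dist G u v \<le> graph_dist G u w + graph_dist G w v"
      using graph_dist_triangle[of u w v] assms v w by (auto dest: wellformed')
    also have "\<dots> \<le> graph_dist G u x + graph_dist G w v"
      using max w by (simp add: maximally_distant_def)
    finally show "graph_dist G u x + graph_dist G x v \<noteq> graph_dist G u v"
      using w by simp
  qed
next
  assume R: "\<forall>v\<in>pverts G - {x}. graph_dist G u x + graph_dist G x v \<noteq> graph_dist G u v"
  show "maximally_distant G u x"
    unfolding maximally_distant_def
  proof (intro allI impI, rule ccontr)
    fix w assume w: "(x, w) \<in> parcs G" "\<not> graph_dist G u w \<le> graph_dist G u x"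
    have "w \<in> pverts G" "w \<noteq> x"
      using w by (auto dest: wellformed')
    moreover have "graph_dist G u w \<le> graph_dist G u x + graph_dist G x w"
      using graph_dist_triangle[of u x w] assms \<open>w \<in> pverts G\<close> by simp
    \<comment> \<open>The neighbour \<open>w\<close> itself serves as \<open>v\<close>: it is
      exactly one step farther from \<open>u\<close> than \<open>x\<close>.\<close>
    ultimately have "graph_dist G u x + graph_dist G x w = graph_dist G u w"
      using w(2) graph_dist_arc[OF w(1)] by simp
    with R \<open>w \<in> pverts G\<close> \<open>w \<noteq> x\<close> show False by blast
  qed
qed

lemma outer_general_position_iff:
  "outer_general_position G X \<longleftrightarrow>
    X \<subseteq> pverts G \<and> (\<forall>u\<in>X. \<forall>x\<in>X. u \<noteq> x \<longrightarrow> maximally_distant G u x)"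
proof (cases "X \<subseteq> pverts G")
  case True
  have pos: "positionable G X u v \<longleftrightarrow>
      (\<forall>x\<in>X - {u, v}. graph_dist G u x + graph_dist G x v \<noteq> graph_dist G u v)"
    if "u \<in> X" "v \<in> pverts G" for u v
    using in_shortest_path_iff[of u v] that True unfolding positionable_def by blast
  \<comment> \<open>\<open>X\<close> and its complement together exhaust the vertices, so both
    positionability conditions merge into one with \<open>v\<close> arbitrary.\<close>
  have "outer_general_position G X \<longleftrightarrow> (\<forall>u\<in>X. \<forall>v\<in>pverts G. positionable G X u v)"
    using True unfolding outer_general_position_def by blast
  also have "\<dots> \<longleftrightarrow> (\<forall>u\<in>X. \<forall>v\<in>pverts G. \<forall>x\<in>X - {u, v}.
      graph_dist G u x + graph_dist G x v \<noteq> graph_dist G u v)"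
    using pos by simp
  \<comment> \<open>Only the quantifiers are reordered: with \<open>u\<close> and \<open>x\<close>
    fixed first, the condition on \<open>v\<close> is the one characterising maximal
    distance.\<close>
  also have "\<dots> \<longleftrightarrow> (\<forall>u\<in>X. \<forall>x\<in>X. u \<noteq> x \<longrightarrow>
      (\<forall>v\<in>pverts G - {x}. graph_dist G u x + graph_dist G x v \<noteq> graph_dist G u v))"
    by fastforce
  also have "\<dots> \<longleftrightarrow> (\<forall>u\<in>X. \<forall>x\<in>X. u \<noteq> x \<longrightarrow> maximally_distant G u x)"
    using maximally_distant_iff True by (meson subsetD)
  finally show ?thesis using True by simp
qed (simp add: outer_general_position_def)

lemma outer_general_position_subset:
  "outer_general_position G X \<Longrightarrow> Y \<subseteq> X \<Longrightarrow> outer_general_position G Y"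
  unfolding outer_general_position_iff by blast

lemma not_maximally_distant_self:
  assumes "card (pverts G) \<ge> 2" "u \<in> pverts G"
  shows "\<not> maximally_distant G u u"
proof -
  have "pverts G \<noteq> {u}" using assms(1) by auto
  then obtain v where "v \<in> pverts G" "u \<noteq> v" using assms(2) by blast
  then obtain w where "(u, w) \<in> parcs G"
    using graph_dist_step[of u v] assms(2) by blast
  then show ?thesis
    using graph_dist_arc[of u w] by (auto simp: maximally_distant_def)
qed

lemma card_le_gp_outer: "outer_general_position G X \<Longrightarrow> card X \<le> gp_outer G"
  unfolding gp_outer_def
  by (rule Max_ge) (auto intro: finite_outer_general_position_cards[OF pair_finite_verts])

text \<open>Every size up to the maximum occurs because the property passes to subsets. This allows
  sets of equal size to be chosen in two different graphs.\<close>

lemma gp_outer_attained: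
  assumes "m \<le> gp_outer G"
  obtains X where "outer_general_position G X" "card X = m" "finite X"
proof -
  have "gp_outer G \<in> {card X | X. outer_general_position G X}"
    unfolding gp_outer_def
    using finite_outer_general_position_cards[OF pair_finite_verts] outer_general_position_empty
    by (intro Max_in) auto
  then obtain Y where Y: "outer_general_position G Y" "card Y = gp_outer G" by auto
  then obtain X where "X \<subseteq> Y" "card X = m" "finite X"
    using assms by (metis obtain_subset_with_card_n)
  with Y(1) show thesis
    using outer_general_position_subset that by blast
qed

end

lemma connected_pair_graphI:
  assumes "pair_graph G" "Digraph_Component.connected (with_proj G)"
  shows "connected_pair_graph G"
proof -
  interpret pair_graph G by fact
  \<comment> \<open>\<open>connected\<close> means strong connectivity of the symmetric closure,
    which adds no arcs here.\<close>
  have arcs: "parcs (mk_symmetric (with_proj G)) = parcs G"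
    using pair_sym_arcs by (auto simp: mk_symmetric_def symmetric_def sym_def)
  have "(u, v) \<in> (parcs G)\<^sup>*" if "u \<in> pverts G" "v \<in> pverts G" for u v
  proof -
    have "u \<rightarrow>\<^sup>*\<^bsub>with_proj (mk_symmetric (with_proj G))\<^esub> v"
      using assms(2) that
      by (auto simp: Digraph_Component.connected_def strongly_connected_def mk_symmetric_def)
    from reachable_rtranclI[OF this] show ?thesis by (simp add: arcs)
  qed
  then show ?thesis by unfold_locales
qed

section \<open>Distances in Cartesian products\<close>

locale connected_pair_graph_product = G: connected_pair_graph G + H: connected_pair_graph H
  for G :: "'a pair_pre_digraph" and H :: "'b pair_pre_digraph"
begin

lemma arc_cartesian_product_iff:
  "((g, h), (g', h')) \<in> parcs (G \<box> H) \<longleftrightarrow>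
    (g, g') \<in> parcs G \<and> h = h' \<and> h \<in> pverts H \<or> g = g' \<and> g \<in> pverts G \<and> (h, h') \<in> parcs H"
  by (auto simp: cartesian_product_def)

lemma relpow_cartesian_product_fst:
  "(g, g') \<in> parcs G ^^ n \<Longrightarrow> h \<in> pverts H \<Longrightarrow> ((g, h), (g', h)) \<in> parcs (G \<box> H) ^^ n"
proof (induction n arbitrary: g')
  case (Suc n)
  then show ?case by (force simp: arc_cartesian_product_iff)
qed simp

lemma relpow_cartesian_product_snd:
  "(h, h') \<in> parcs H ^^ n \<Longrightarrow> g \<in> pverts G \<Longrightarrow> ((g, h), (g, h')) \<in> parcs (G \<box> H) ^^ n"
proof (induction n arbitrary: h')
  case (Suc n)
  then show ?case by (force simp: arc_cartesian_product_iff)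
qed simp

text \<open>The walk first moves within the copy of \<open>G\<close> at \<open>h\<close>, then
  within the copy of \<open>H\<close> at \<open>g'\<close>.\<close>

lemma relpow_cartesian_product_dist:
  assumes "g \<in> pverts G" "h \<in> pverts H" "g' \<in> pverts G" "h' \<in> pverts H"
  shows "((g, h), (g', h')) \<in> parcs (G \<box> H) ^^ (graph_dist G g g' + graph_dist H h h')"
  using relpow_cartesian_product_fst[OF G.relpow_graph_dist[OF assms(1,3)] assms(2)]
    relpow_cartesian_product_snd[OF H.relpow_graph_dist[OF assms(2,4)] assms(3)]
  by (auto simp: relpow_add)

sublocale prod: connected_pair_graph "G \<box> H"
proof -
  interpret pair_graph "G \<box> H"
    by (intro pair_graph_cartesian_product G.pair_graph_axioms H.pair_graph_axioms)
  show "connected_pair_graph (G \<box> H)"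
  proof
    fix u v assume "u \<in> pverts (G \<box> H)" "v \<in> pverts (G \<box> H)"
    then show "(u, v) \<in> (parcs (G \<box> H))\<^sup>*"
      using relpow_cartesian_product_dist[of "fst u" "snd u" "fst v" "snd v"]
      by (auto simp: cartesian_product_def intro: relpow_imp_rtrancl)
  qed
qed

text \<open>Each arc moves one coordinate along one arc of its factor, so the sum of the two
  distances grows by at most one per step. Membership of the endpoint is carried through the
  induction for the triangle inequality.\<close>

lemma relpow_cartesian_product_ge:
  assumes "((g, h), (g', h')) \<in> parcs (G \<box> H) ^^ n" "g \<in> pverts G" "h \<in> pverts H"
  shows "g' \<in> pverts G \<and> h' \<in> pverts H \<and> graph_dist G g g' + graph_dist H h h' \<le> n"
  using assms(1)
proof (induction n arbitrary: g' h')
  case 0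
  then show ?case using assms by simp
next
  case (Suc n)
  from Suc.prems obtain a b where step: "((g, h), (a, b)) \<in> parcs (G \<box> H) ^^ n"
    "((a, b), (g', h')) \<in> parcs (G \<box> H)"
    by auto
  note IH = Suc.IH[OF step(1)]
  from step(2) consider "(a, g') \<in> parcs G" "b = h'" | "a = g'" "(b, h') \<in> parcs H"
    unfolding arc_cartesian_product_iff by blast
  then show ?case
  proof cases
    case 1
    then show ?thesis
      using IH G.graph_dist_triangle[of g a g'] G.graph_dist_arc[of a g'] assms(2)
        G.wellformed'(2)[of a g'] by simp
  next
    case 2
    then show ?thesis
      using IH H.graph_dist_triangle[of h b h'] H.graph_dist_arc[of b h'] assms(3)
        H.wellformed'(2)[of b h'] by simp
  qed
qed

lemma graph_dist_cartesian_product: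
  assumes "g \<in> pverts G" "h \<in> pverts H" "g' \<in> pverts G" "h' \<in> pverts H"
  shows "graph_dist (G \<box> H) (g, h) (g', h') = graph_dist G g g' + graph_dist H h h'"
proof (rule antisym)
  show "graph_dist (G \<box> H) (g, h) (g', h') \<le> graph_dist G g g' + graph_dist H h h'"
    by (intro graph_dist_le relpow_cartesian_product_dist assms)
  have "((g, h), (g', h')) \<in> parcs (G \<box> H) ^^ graph_dist (G \<box> H) (g, h) (g', h')"
    using assms by (intro prod.relpow_graph_dist) (auto simp: cartesian_product_def)
  then show "graph_dist G g g' + graph_dist H h h' \<le> graph_dist (G \<box> H) (g, h) (g', h')"
    using relpow_cartesian_product_ge assms by blast
qed

text \<open>A neighbour of \<open>(g', h')\<close> differs in just one coordinate, and the distance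
  contributed by the other cancels from the comparison.\<close>

lemma maximally_distant_cartesian_product:
  assumes "g \<in> pverts G" "h \<in> pverts H" "g' \<in> pverts G" "h' \<in> pverts H"
  shows "maximally_distant (G \<box> H) (g, h) (g', h') \<longleftrightarrow>
    maximally_distant G g g' \<and> maximally_distant H h h'" (is "?P \<longleftrightarrow> _")
proof -
  have "?P \<longleftrightarrow>
    (\<forall>w. (g', w) \<in> parcs G \<longrightarrow>
      graph_dist (G \<box> H) (g, h) (w, h') \<le> graph_dist (G \<box> H) (g, h) (g', h')) \<and>
    (\<forall>w. (h', w) \<in> parcs H \<longrightarrow>
      graph_dist (G \<box> H) (g, h) (g', w) \<le> graph_dist (G \<box> H) (g, h) (g', h'))"
    using assms unfolding maximally_distant_def split_paired_All arc_cartesian_product_iff by blast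
  then show ?thesis
    using assms G.wellformed'(2)[of g'] H.wellformed'(2)[of h']
    by (simp add: graph_dist_cartesian_product maximally_distant_def)
qed

section \<open>The two inequalities for the outer general position number\<close>

lemma card_le_min_gp_outer:
  assumes "card (pverts G) \<ge> 2" "card (pverts H) \<ge> 2" "outer_general_position (G \<box> H) X"
  shows "card X \<le> min (gp_outer G) (gp_outer H)"
proof -
  have sub: "fst z \<in> pverts G" "snd z \<in> pverts H" if "z \<in> X" for z
    using that assms(3) by (auto simp: outer_general_position_def cartesian_product_def)
  \<comment> \<open>Only the pairs are assumed distinct. A shared coordinate would be maximally
    distant from itself, which yields the injectivity below.\<close>
  have max: "maximally_distant G (fst y) (fst z)" "maximally_distant H (snd y) (snd z)"
    if "y \<in> X" "z \<in> X" "y \<noteq> z" for y z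
    using that assms(3) sub
      maximally_distant_cartesian_product[of "fst y" "snd y" "fst z" "snd z"]
    by (auto simp: prod.outer_general_position_iff)
  have inj: "inj_on fst X" "inj_on snd X"
    using max sub G.not_maximally_distant_self[OF assms(1)]
      H.not_maximally_distant_self[OF assms(2)]
    by (metis inj_onI)+
  have "outer_general_position G (fst ` X)"
    using max(1) sub(1) unfolding G.outer_general_position_iff by blast
  moreover have "outer_general_position H (snd ` X)"
    using max(2) sub(2) unfolding H.outer_general_position_iff by blast
  ultimately show ?thesis
    using G.card_le_gp_outer H.card_le_gp_outer inj by (metis card_image min.boundedI)
qed

lemma outer_general_position_bij_graph:
  assumes "outer_general_position G A" "outer_general_position H B" "bij_betw f A B"
  shows "outer_general_position (G \<box> H) ((\<lambda>a. (a, f a)) ` A)"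
proof -
  have A: "a \<in> pverts G" and f: "f a \<in> B" "f a \<in> pverts H" if "a \<in> A" for a
    using that assms by (auto simp: outer_general_position_def bij_betw_def)
  have "maximally_distant (G \<box> H) (a, f a) (b, f b)" if "a \<in> A" "b \<in> A" "a \<noteq> b" for a b
  proof -
    \<comment> \<open>Both coordinates must differ, since the factors give maximal distance only
      between distinct vertices.\<close>
    have "f a \<noteq> f b" using that assms(3) by (auto simp: bij_betw_def inj_on_def)
    then show ?thesis
      using that assms(1,2) A f
      by (auto simp: maximally_distant_cartesian_product G.outer_general_position_iff
          H.outer_general_position_iff)
  qed
  moreover have "(\<lambda>a. (a, f a)) ` A \<subseteq> pverts (G \<box> H)"
    using A f by (auto simp: cartesian_product_def)
  ultimately show ?thesis
    unfolding prod.outer_general_position_iff by blast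
qed

lemma min_gp_outer_le: "min (gp_outer G) (gp_outer H) \<le> gp_outer (G \<box> H)"
proof -
  \<comment> \<open>Both sets are taken of the smaller size, so that a bijection between them
    exists.\<close>
  obtain A where A: "outer_general_position G A" "card A = min (gp_outer G) (gp_outer H)" "finite A"
    using G.gp_outer_attained[OF min.cobounded1] by blast
  obtain B where B: "outer_general_position H B" "card B = min (gp_outer G) (gp_outer H)" "finite B"
    using H.gp_outer_attained[OF min.cobounded2] by blast
  obtain f where "bij_betw f A B"
    using A B by (metis finite_same_card_bij)
  from prod.card_le_gp_outer[OF outer_general_position_bij_graph[OF A(1) B(1) this]]
  have "card ((\<lambda>a. (a, f a)) ` A) \<le> gp_outer (G \<box> H)" .
  moreover have "card ((\<lambda>a. (a, f a)) ` A) = card A"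
    by (intro card_image inj_onI) simp
  ultimately show ?thesis using A(2) by simp
qed

end

theorem theorem4p3:
  fixes G :: "'a pair_pre_digraph" and H :: "'b pair_pre_digraph"
  assumes "pair_graph G" and "pair_graph H"
    and "Digraph_Component.connected (with_proj G)" and "Digraph_Component.connected (with_proj H)"
    and "card (pverts G) \<ge> 2" and "card (pverts H) \<ge> 2"
  shows "gp_outer (G \<box> H) = min (gp_outer G) (gp_outer H)"
proof -
  interpret connected_pair_graph_product G H
    using assms by (intro connected_pair_graph_product.intro connected_pair_graphI)
  obtain X where "outer_general_position (G \<box> H) X" "card X = gp_outer (G \<box> H)"
    using prod.gp_outer_attained by blast
  then show ?thesis
    using card_le_min_gp_outer[OF assms(5,6)] min_gp_outer_le by fastforce
qed

end
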